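(* Let $(\mathfrak g,\pi)$ and $(\mathfrak h,\mu)$ be finite-dimensional real $3$-Lie algebras. If $f_t:\mathfrak g\to\mathfrak h$ is a deformation of a $3$-Lie algebra morphism $f:\mathfrak g\to\mathfrak h$, then there is a deformation of the $3$-Lie subalgebra $\mathrm G_f=\{(x,f(x))\mid x\in\mathfrak g\}$ in $\mathfrak g\oplus\mathfrak h$, where the $3$-Lie algebra structure on $\mathfrak g\oplus\mathfrak h$ is given by $[(x,u),(y,v),(z,w)]_{\mathfrak g\oplus\mathfrak h}=\big(\pi(x,y,z),\mu(u,v,w)\big)$ for all $x,y,z\in\mathfrak g$, $u,v,w\in\mathfrak h$.
   Context: A $3$-Lie algebra is a vector space $\mathfrak g$ with a linear map $\pi:\wedge^3\mathfrak g\to\mathfrak g$ such that $\pi(x_1,x_2,\pi(x_3,x_4,x_5))=\pi(\pi(x_1,x_2,x_3),x_4,x_5)+\pi(x_3,\pi(x_1,x_2,x_4),x_5)+\pi(x_3,x_4,\pi(x_1,x_2,x_5))$ for all $x_i\in\mathfrak g$. A $3$-Lie algebra morphism $(\mathfrak g,\pi)\to(\mathfrak h,\mu)$ is a linear map $f$ with $f(\pi(x,y,z))=\mu(f(x),f(y),f(z))$. A $3$-Lie subalgebra is a subspace closed under the bracket. A deformation of a $3$-Lie algebra morphism $f$ is a smooth one-parameter family $f_t$ ($t$ in an open interval containing $0$) of $3$-Lie algebra morphisms from $(\mathfrak g,\pi)$ to $(\mathfrak h,\mu)$ with $f_0=f$. For a $3$-Lie algebra $\mathfrak k$ and a $k$-dimensional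 $3$-Lie subalgebra $\mathfrak s\subset\mathfrak k$, a deformation of $\mathfrak s$ in $\mathfrak k$ is a smooth curve $\mathfrak s_t$ in the Grassmannian $\mathrm{Gr}_k(\mathfrak k)$ of $k$-dimensional subspaces such that $\mathfrak s_0=\mathfrak s$ and $\mathfrak s_t$ is a $3$-Lie subalgebra of $\mathfrak k$ for all $t$. *)

theory Defs
  imports "HOL-Analysis.Analysis"
begin

definition finite_dimensional :: "'v::real_vector itself \<Rightarrow> bool" where
  "finite_dimensional _ \<longleftrightarrow> (\<exists>B::'v set. finite B \<and> span B = UNIV)"

text \<open>
  A linear map \<open>\<And>\<^sup>3 V \<rightarrow> V\<close> is represented by the corresponding alternating trilinear map.
\<close>

definition alternating_trilinear ::
    "('v::real_vector \<Rightarrow> 'v \<Rightarrow> 'v \<Rightarrow> 'v) \<Rightarrow> bool" where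
  "alternating_trilinear b \<longleftrightarrow>
     (\<forall>y z. linear (\<lambda>x. b x y z)) \<and>
     (\<forall>x z. linear (\<lambda>y. b x y z)) \<and>
     (\<forall>x y. linear (\<lambda>z. b x y z)) \<and>
     (\<forall>x y. b x x y = 0 \<and> b x y x = 0 \<and> b y x x = 0)"

definition three_lie_algebra ::
    "('v::real_vector \<Rightarrow> 'v \<Rightarrow> 'v \<Rightarrow> 'v) \<Rightarrow> bool" where
  "three_lie_algebra b \<longleftrightarrow>
     alternating_trilinear b \<and>
     (\<forall>x1 x2 x3 x4 x5.
        b x1 x2 (b x3 x4 x5) =
          b (b x1 x2 x3) x4 x5 + b x3 (b x1 x2 x4) x5 + b x3 x4 (b x1 x2 x5))"

definition three_lie_morphism ::
    "('v::real_vector \<Rightarrow> 'v \<Rightarrow> 'v \<Rightarrow> 'v) \<Rightarrow> ('w::real_vector \<Rightarrow> 'w \<Rightarrow> 'w \<Rightarrow> 'w)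
      \<Rightarrow> ('v \<Rightarrow> 'w) \<Rightarrow> bool" where
  "three_lie_morphism b c f \<longleftrightarrow>
     linear f \<and> (\<forall>x y z. f (b x y z) = c (f x) (f y) (f z))"

definition three_lie_subalgebra ::
    "('v::real_vector \<Rightarrow> 'v \<Rightarrow> 'v \<Rightarrow> 'v) \<Rightarrow> 'v set \<Rightarrow> bool" where
  "three_lie_subalgebra b S \<longleftrightarrow>
     subspace S \<and> (\<forall>x\<in>S. \<forall>y\<in>S. \<forall>z\<in>S. b x y z \<in> S)"

definition direct_sum_bracket ::
    "('v \<Rightarrow> 'v \<Rightarrow> 'v \<Rightarrow> 'v) \<Rightarrow> ('w \<Rightarrow> 'w \<Rightarrow> 'w \<Rightarrow> 'w)
      \<Rightarrow> 'v \<times> 'w \<Rightarrow> 'v \<times> 'w \<Rightarrow> 'v \<times> 'w \<Rightarrow> 'v \<times> 'w" where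
  "direct_sum_bracket b c = (\<lambda>(x, u) (y, v) (z, w). (b x y z, c u v w))"

definition graph_of :: "('v \<Rightarrow> 'w) \<Rightarrow> ('v \<times> 'w) set" where
  "graph_of f = {(x, f x) | x. True}"

definition smooth_real_on :: "real set \<Rightarrow> (real \<Rightarrow> real) \<Rightarrow> bool" where
  "smooth_real_on J g \<longleftrightarrow> (\<forall>n. \<forall>t\<in>J. (deriv ^^ n) g differentiable (at t))"

text \<open>
  No norm is fixed on a finite-dimensional space: a curve is smooth if all its linear
  coordinates are. The sets \<open>J\<close> below are open, so only the values of the curve on \<open>J\<close> matter.
\<close>

definition smooth_curve_on :: "real set \<Rightarrow> (real \<Rightarrow> 'v::real_vector) \<Rightarrow> bool" where
  "smooth_curve_on J c \<longleftrightarrow>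
     (\<forall>\<phi>::'v \<Rightarrow> real. linear \<phi> \<longrightarrow> smooth_real_on J (\<lambda>t. \<phi> (c t)))"

definition parameter_interval :: "real set \<Rightarrow> bool" where
  "parameter_interval I \<longleftrightarrow> open I \<and> is_interval I \<and> 0 \<in> I"

text \<open>To be used in finite-dimensional ambient spaces (\<open>dim\<close> is \<open>0\<close> on infinite-dimensional
  subspaces).\<close>

definition Gr :: "nat \<Rightarrow> 'v::real_vector set set" where
  "Gr k = {S. subspace S \<and> dim S = k}"

definition complementary :: "'v::real_vector set \<Rightarrow> 'v set \<Rightarrow> bool" where
  "complementary P Q \<longleftrightarrow>
     subspace P \<and> subspace Q \<and> P \<inter> Q = {0} \<and> (\<forall>v. \<exists>p\<in>P. \<exists>q\<in>Q. v = p + q)"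

text \<open>
  The standard atlas of the Grassmannian: for complementary \<open>P\<close> and \<open>Q\<close> with \<open>P\<close> of
  dimension \<open>k\<close>, the chart domain consists of the \<open>S\<close> in \<open>Gr k\<close> complementary to \<open>Q\<close>. Such an
  \<open>S\<close> is the graph \<open>{x + A x | x \<in> P}\<close> of a unique linear map \<open>A : P \<rightarrow> Q\<close>, its coordinate in
  \<open>Hom(P, Q)\<close>; \<open>Gr_chart P Q S\<close> is this \<open>A\<close>, to be applied to elements of \<open>P\<close> only.
\<close>

definition Gr_chart_domain :: "nat \<Rightarrow> 'v::real_vector set \<Rightarrow> 'v set set" where
  "Gr_chart_domain k Q = {S \<in> Gr k. complementary S Q}"

definition Gr_chart :: "'v::real_vector set \<Rightarrow> 'v set \<Rightarrow> 'v set \<Rightarrow> 'v \<Rightarrow> 'v" where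
  "Gr_chart P Q S x = (THE y. y \<in> Q \<and> x + y \<in> S)"

text \<open>
  Smoothness of a curve in \<open>Gr k\<close> as a map of manifolds: around each parameter the curve stays
  in some chart, in which it is smooth. A curve in the finite-dimensional space \<open>Hom(P, Q)\<close> is
  smooth iff its evaluation at each element of \<open>P\<close> is.
\<close>

definition smooth_Gr_curve_on ::
    "nat \<Rightarrow> real set \<Rightarrow> (real \<Rightarrow> 'v::real_vector set) \<Rightarrow> bool" where
  "smooth_Gr_curve_on k I s \<longleftrightarrow>
     (\<forall>t\<in>I. s t \<in> Gr k) \<and>
     (\<forall>t0\<in>I. \<exists>J P Q.
        open J \<and> t0 \<in> J \<and> J \<subseteq> I \<and>
        P \<in> Gr k \<and> complementary P Q \<and>
        (\<forall>t\<in>J. s t \<in> Gr_chart_domain k Q) \<and>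
        (\<forall>x\<in>P. smooth_curve_on J (\<lambda>t. Gr_chart P Q (s t) x)))"

text \<open>Smoothness of the family \<open>F\<close> of linear maps is again smoothness of all evaluations.\<close>

definition morphism_deformation ::
    "('v::real_vector \<Rightarrow> 'v \<Rightarrow> 'v \<Rightarrow> 'v) \<Rightarrow> ('w::real_vector \<Rightarrow> 'w \<Rightarrow> 'w \<Rightarrow> 'w)
      \<Rightarrow> ('v \<Rightarrow> 'w) \<Rightarrow> real set \<Rightarrow> (real \<Rightarrow> 'v \<Rightarrow> 'w) \<Rightarrow> bool" where
  "morphism_deformation b c f I F \<longleftrightarrow>
     parameter_interval I \<and>
     (\<forall>t\<in>I. three_lie_morphism b c (F t)) \<and>
     (\<forall>x. smooth_curve_on I (\<lambda>t. F t x)) \<and>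
     F 0 = f"

definition subalgebra_deformation ::
    "('v::real_vector \<Rightarrow> 'v \<Rightarrow> 'v \<Rightarrow> 'v) \<Rightarrow> 'v set \<Rightarrow> real set \<Rightarrow> (real \<Rightarrow> 'v set) \<Rightarrow> bool" where
  "subalgebra_deformation b S I s \<longleftrightarrow>
     three_lie_algebra b \<and> three_lie_subalgebra b S \<and>
     parameter_interval I \<and>
     smooth_Gr_curve_on (dim S) I s \<and>
     (\<forall>t\<in>I. three_lie_subalgebra b (s t)) \<and>
     s 0 = S"

end

theory Submission
  imports Defs
begin

text \<open>
  The deformation is \<open>t \<mapsto> graph_of (F t)\<close>. A single chart of the Grassmannian contains the whole
  curve, namely the one given by the splitting into \<open>\<gg> \<oplus> 0\<close> and \<open>0 \<oplus> \<hh>\<close>; its coordinate at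
  parameter \<open>t\<close> is \<open>F t\<close> itself, so smoothness of the curve is smoothness of \<open>F\<close>.
\<close>

lemma mem_graph_of [simp]: "(x, u) \<in> graph_of f \<longleftrightarrow> u = f x"
  by (auto simp: graph_of_def)

text \<open>As the image of a linear embedding, the graph gets its subspace property and its
  dimension from facts about linear images.\<close>

lemma graph_of_eq_image: "graph_of f = (\<lambda>x. (x, f x)) ` UNIV"
  by (auto simp: graph_of_def)

lemma linear_graph_embedding:
  fixes f :: "'g::real_vector \<Rightarrow> 'h::real_vector"
  assumes "linear f"
  shows "linear (\<lambda>x. (x, f x))"
  using assms by (simp add: linear_iff)

text \<open>An injective linear map carries a basis of \<open>S\<close> to a basis of the image,
  with the same cardinality.\<close>

lemma dim_injective_linear_image:
  fixes L :: "'v::real_vector \<Rightarrow> 'w::real_vector"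
  assumes "linear L" and "inj L"
  shows "dim (L ` S) = dim S"
proof -
  obtain B where B: "B \<subseteq> S" "independent B" "S \<subseteq> span B" "card B = dim S"
    using basis_exists by blast
  have "inj_on L A" for A
    using assms(2) by (rule inj_on_subset) simp
  then have "independent (L ` B)" and "card (L ` B) = card B"
    using B(2) assms(1) by (simp_all add: linear_independent_injective_image card_image)
  moreover have "L ` S \<subseteq> span (L ` B)"
    using B(3) assms(1) by (auto simp: linear_span_image)
  ultimately show ?thesis
    using B by (metis dim_unique image_mono)
qed

lemma subspace_graph_of:
  assumes "linear f"
  shows "subspace (graph_of f)"
  unfolding graph_of_eq_image
  by (intro linear_subspace_image linear_graph_embedding assms subspace_UNIV)

lemma dim_graph_of:
  fixes f :: "'g::real_vector \<Rightarrow> 'h::real_vector"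
  assumes "linear f"
  shows "dim (graph_of f) = dim (UNIV :: 'g set)"
  unfolding graph_of_eq_image
  by (intro dim_injective_linear_image linear_graph_embedding assms) (simp add: inj_on_def)

lemma graph_of_in_Gr:
  fixes f :: "'g::real_vector \<Rightarrow> 'h::real_vector"
  assumes "linear f"
  shows "graph_of f \<in> Gr (dim (UNIV :: 'g set))"
  using assms by (simp add: Gr_def subspace_graph_of dim_graph_of)

text \<open>Each \<open>(x, u)\<close> splits as \<open>(x, f x) + (0, u - f x)\<close>, and the
  intersection is trivial because \<open>f 0 = 0\<close>.\<close>

lemma complementary_graph_of:
  fixes f :: "'g::real_vector \<Rightarrow> 'h::real_vector"
  assumes "linear f"
  shows "complementary (graph_of f) ({0} \<times> UNIV)"
proof -
  have "\<exists>p\<in>graph_of f. \<exists>q\<in>{0} \<times> UNIV. v = p + q" for v :: "'g \<times> 'h"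
    by (rule bexI[of _ "(fst v, f (fst v))"], rule bexI[of _ "(0, snd v - f (fst v))"])
      (auto simp: prod_eq_iff)
  moreover have "subspace ({0} \<times> UNIV :: ('g \<times> 'h) set)"
    by (simp add: subspace_def zero_prod_def)
  ultimately show ?thesis
    using assms unfolding complementary_def
    by (auto simp: subspace_graph_of linear_0 zero_prod_def)
qed

text \<open>Adding an element of \<open>{0} \<times> UNIV\<close> to \<open>(x, 0)\<close> keeps the
  first component \<open>x\<close>, so lying on the graph forces the second component to be
  \<open>f x\<close>.\<close>

lemma Gr_chart_graph_of:
  "Gr_chart P ({0} \<times> UNIV) (graph_of f) (x, 0) = (0, f x)"
  unfolding Gr_chart_def by (rule the_equality) auto

text \<open>Smoothness is tested on linear functionals, and a functional composed with
  \<open>L\<close> is again one.\<close>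

lemma smooth_curve_on_linear_image:
  fixes L :: "'v::real_vector \<Rightarrow> 'w::real_vector"
  assumes "smooth_curve_on J c" and "linear L"
  shows "smooth_curve_on J (\<lambda>t. L (c t))"
  unfolding smooth_curve_on_def
proof (intro allI impI)
  fix \<phi> :: "'w \<Rightarrow> real"
  assume "linear \<phi>"
  then have "linear (\<lambda>v. \<phi> (L v))"
    using linear_compose[OF assms(2)] by (simp add: o_def)
  then show "smooth_real_on J (\<lambda>t. \<phi> (L (c t)))"
    using assms(1) unfolding smooth_curve_on_def by blast
qed

lemma smooth_Gr_curve_on_graph_of:
  fixes F :: "real \<Rightarrow> 'g::real_vector \<Rightarrow> 'h::real_vector"
  assumes "open I" and "\<And>t. t \<in> I \<Longrightarrow> linear (F t)"
    and "\<And>x. smooth_curve_on I (\<lambda>t. F t x)"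
  shows "smooth_Gr_curve_on (dim (UNIV :: 'g set)) I (\<lambda>t. graph_of (F t))"
proof -
  \<comment> \<open>Writing the summand \<gg> + 0 as the graph of the zero map makes its dimension
    and its complementarity to \<open>Q\<close> instances of the graph lemmas.\<close>
  define P :: "('g \<times> 'h) set" where "P = graph_of (\<lambda>_. 0)"
  define Q :: "('g \<times> 'h) set" where "Q = {0} \<times> UNIV"
  have zero: "linear (\<lambda>_::'g. 0::'h)"
    by (simp add: linear_iff)
  have chart: "smooth_curve_on I (\<lambda>t. Gr_chart P Q (graph_of (F t)) p)" if p: "p \<in> P" for p
  proof -
    obtain x where "p = (x, 0)"
      using p by (auto simp: P_def graph_of_def)
    moreover have "linear (\<lambda>u::'h. (0::'g, u))"
      by (simp add: linear_iff)
    \<comment> \<open>The coordinate at \<open>(x, 0)\<close> is \<open>(0, F t x)\<close>, the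
      image of the smooth curve \<open>F t x\<close> under the linear inclusion of the second
      summand.\<close>
    ultimately show ?thesis
      using smooth_curve_on_linear_image[OF assms(3)] by (simp add: Q_def Gr_chart_graph_of)
  qed
  have "P \<in> Gr (dim (UNIV :: 'g set))" and "complementary P Q"
    unfolding P_def Q_def using zero by (auto intro: graph_of_in_Gr complementary_graph_of)
  moreover have "graph_of (F t) \<in> Gr_chart_domain (dim (UNIV :: 'g set)) Q" if "t \<in> I" for t
    using assms(2)[OF that] unfolding Gr_chart_domain_def Q_def
    by (simp add: graph_of_in_Gr complementary_graph_of)
  \<comment> \<open>The same \<open>P\<close> and \<open>Q\<close>, with \<open>J = I\<close>, serve
    around every parameter.\<close>
  ultimately show ?thesis
    unfolding smooth_Gr_curve_on_def using assms(1,2) chart graph_of_in_Gr by blast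
qed

lemma alternating_trilinear_direct_sum:
  assumes "alternating_trilinear b" and "alternating_trilinear c"
  shows "alternating_trilinear (direct_sum_bracket b c)"
  using assms unfolding alternating_trilinear_def direct_sum_bracket_def linear_iff
  by (simp add: split_beta prod_eq_iff)

lemma three_lie_algebra_direct_sum:
  assumes "three_lie_algebra \<pi>" and "three_lie_algebra \<mu>"
  shows "three_lie_algebra (direct_sum_bracket \<pi> \<mu>)"
  unfolding three_lie_algebra_def
proof (intro conjI allI)
  show "alternating_trilinear (direct_sum_bracket \<pi> \<mu>)"
    using assms by (simp add: three_lie_algebra_def alternating_trilinear_direct_sum)
next
  fix x1 x2 x3 x4 x5
  show "direct_sum_bracket \<pi> \<mu> x1 x2 (direct_sum_bracket \<pi> \<mu> x3 x4 x5) =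
      direct_sum_bracket \<pi> \<mu> (direct_sum_bracket \<pi> \<mu> x1 x2 x3) x4 x5 +
      direct_sum_bracket \<pi> \<mu> x3 (direct_sum_bracket \<pi> \<mu> x1 x2 x4) x5 +
      direct_sum_bracket \<pi> \<mu> x3 x4 (direct_sum_bracket \<pi> \<mu> x1 x2 x5)"
    \<comment> \<open>The identity splits into its two components, which are the fundamental
      identities of \<open>\<pi>\<close> and \<open>\<mu>\<close>.\<close>
    unfolding direct_sum_bracket_def split_beta prod_eq_iff fst_add snd_add fst_conv snd_conv
    using assms by (intro conjI) (unfold three_lie_algebra_def, blast+)
qed

text \<open>The bracket of three graph points has components \<open>\<pi> x y z\<close> and
  \<open>\<mu> (f x) (f y) (f z)\<close>; the latter is \<open>f (\<pi> x y z)\<close> since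
  \<open>f\<close> is a morphism.\<close>

lemma three_lie_subalgebra_graph_of:
  assumes "three_lie_morphism \<pi> \<mu> f"
  shows "three_lie_subalgebra (direct_sum_bracket \<pi> \<mu>) (graph_of f)"
  using assms unfolding three_lie_subalgebra_def three_lie_morphism_def
  by (auto simp: subspace_graph_of direct_sum_bracket_def)

theorem proposition5p6:
  fixes \<pi> :: "'g::real_vector \<Rightarrow> 'g \<Rightarrow> 'g \<Rightarrow> 'g"
    and \<mu> :: "'h::real_vector \<Rightarrow> 'h \<Rightarrow> 'h \<Rightarrow> 'h"
    and f :: "'g \<Rightarrow> 'h"
    and I :: "real set"
    and F :: "real \<Rightarrow> 'g \<Rightarrow> 'h"
  assumes "finite_dimensional TYPE('g)"
    and "finite_dimensional TYPE('h)"
    and "three_lie_algebra \<pi>"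
    and "three_lie_algebra \<mu>"
    and "three_lie_morphism \<pi> \<mu> f"
    and "morphism_deformation \<pi> \<mu> f I F"
  shows "\<exists>s. subalgebra_deformation (direct_sum_bracket \<pi> \<mu>) (graph_of f) I s \<and>
             (\<forall>t\<in>I. s t = graph_of (F t))"
proof -
  have I: "parameter_interval I" and mor: "\<And>t. t \<in> I \<Longrightarrow> three_lie_morphism \<pi> \<mu> (F t)"
    and smooth: "\<And>x. smooth_curve_on I (\<lambda>t. F t x)" and F0: "F 0 = f"
    using assms(6) by (auto simp: morphism_deformation_def)
  \<comment> \<open>Linearity of \<open>f\<close> gives \<open>dim (graph_of f) = dim UNIV\<close>,
    which matches the Grassmannian index in the definition of a subalgebra deformation with the one
    in the smoothness lemma.\<close>
  have "linear f"
    using assms(5) by (simp add: three_lie_morphism_def)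
  moreover have "smooth_Gr_curve_on (dim (UNIV :: 'g set)) I (\<lambda>t. graph_of (F t))"
    using I mor smooth
    by (intro smooth_Gr_curve_on_graph_of) (auto simp: parameter_interval_def three_lie_morphism_def)
  ultimately have "subalgebra_deformation (direct_sum_bracket \<pi> \<mu>) (graph_of f) I
      (\<lambda>t. graph_of (F t))"
    unfolding subalgebra_deformation_def
    using assms(3-5) I mor F0
    by (simp add: dim_graph_of three_lie_algebra_direct_sum three_lie_subalgebra_graph_of)
  then show ?thesis
    by blast
qed

end
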